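(* Let $A_1\in\mathbb{R}^{n\times n}$ be a $P$-matrix, $q\in\mathbb{R}^n$, $r>0$, let $A_1=M_1-N_1$ with $M_1,N_1\in\mathbb{R}^{n\times n}$, so that $A_1=(M_1+I-L_1)-(N_1+I-L_1)$, let $\Omega_1\in\mathbb{R}^{n\times n}$ be a positive diagonal matrix, and suppose $M_1+\Omega_1+I-L_1$ is nonsingular. Let $s^*\in\mathbb{R}^n$ be the solution of $$s=(M_1+\Omega_1+I-L_1)^{-1}\big[(N_1+I-L_1)s+(\Omega_1-A_1)|s|-rq\big].$$ Suppose that $$\rho\Big(\big|(M_1+I-L_1+\Omega_1)^{-1}\big|\,\big(|N_1+I-L_1|+|\Omega_1-A_1|\big)\Big)<1 .$$ Then for any initial vector $s^{(0)}\in\mathbb{R}^n$, the sequence $\{s^{(k)}\}_{k=1}^{+\infty}$ defined by $$s^{(k+1)}=(M_1+\Omega_1+I-L_1)^{-1}\big[(N_1+I-L_1)s^{(k)}+(\Omega_1-A_1)|s^{(k)}|-rq\big],\qquad k=0,1,2,\ldots$$ converges to $s^*$.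
   Context: For a matrix or vector $X$, $|X|$ denotes the entrywise absolute value. $\rho(\cdot)$ is the spectral radius. $I$ is the identity matrix of order $n$. Write $A_1=D_1-L_1-U_1$ with $D_1$ diagonal, $L_1$ strictly lower triangular and $U_1$ strictly upper triangular; $L_1$ is the strictly lower triangular matrix in this decomposition. A positive diagonal matrix is a diagonal matrix with positive diagonal entries. A $P$-matrix is a real square matrix all of whose principal minors are positive. *)

theory Defs
  imports
    Complex_Main
    "Jordan_Normal_Form.Determinant"
    "Jordan_Normal_Form.DL_Submatrix"
    "Jordan_Normal_Form.Gauss_Jordan_Elimination"
    "Jordan_Normal_Form.Spectral_Radius"
begin

definition abs_mat :: "real mat \<Rightarrow> real mat" where
  "abs_mat X = map_mat abs X"

definition abs_vec :: "real vec \<Rightarrow> real vec" where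
  "abs_vec x = map_vec abs x"

text \<open>The library's spectral radius is defined for complex matrices only; the eigenvalues of a
  real matrix are those of its complexification.\<close>

definition real_spectral_radius :: "real mat \<Rightarrow> real" where
  "real_spectral_radius X = spectral_radius (map_mat complex_of_real X)"

text \<open>Meaningful only for invertible matrices, where \<^const>\<open>mat_inverse\<close> returns
  \<^const>\<open>Some\<close> of the two-sided inverse.\<close>

definition mat_inv :: "real mat \<Rightarrow> real mat" where
  "mat_inv X = the (mat_inverse X)"

definition P_matrix :: "real mat \<Rightarrow> bool" where
  "P_matrix A \<longleftrightarrow> square_mat A \<and>
    (\<forall>I. I \<noteq> {} \<and> I \<subseteq> {..<dim_row A} \<longrightarrow> det (submatrix A I I) > 0)"

definition positive_diagonal_mat :: "real mat \<Rightarrow> bool" where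
  "positive_diagonal_mat X \<longleftrightarrow> square_mat X \<and> diagonal_mat X \<and> (\<forall>i<dim_row X. X $$ (i, i) > 0)"

definition strictly_lower_triangular :: "real mat \<Rightarrow> bool" where
  "strictly_lower_triangular X \<longleftrightarrow>
    square_mat X \<and> (\<forall>i<dim_row X. \<forall>j<dim_col X. i \<le> j \<longrightarrow> X $$ (i, j) = 0)"

definition strictly_upper_triangular :: "real mat \<Rightarrow> bool" where
  "strictly_upper_triangular X \<longleftrightarrow>
    square_mat X \<and> (\<forall>i<dim_row X. \<forall>j<dim_col X. j \<le> i \<longrightarrow> X $$ (i, j) = 0)"

text \<open>Convergence in $\mathbb{R}^n$; the type \<^typ>\<open>real vec\<close> contains vectors of all
  dimensions and carries no topology, so convergence is taken componentwise.\<close>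

definition vec_converges :: "nat \<Rightarrow> (nat \<Rightarrow> real vec) \<Rightarrow> real vec \<Rightarrow> bool" where
  "vec_converges n x l \<longleftrightarrow>
    (\<forall>k. x k \<in> carrier_vec n) \<and> l \<in> carrier_vec n \<and>
    (\<forall>i<n. (\<lambda>k. x k $ i) \<longlonglongrightarrow> l $ i)"

end

theory Submission
  imports Defs
begin

text \<open>
  The iteration map is \<open>x \<mapsto> B (C x + W \<bar>x\<bar> - p)\<close> with
  \<open>B = (M\<^sub>1 + \<Omega>\<^sub>1 + I - L\<^sub>1)\<^sup>-\<^sup>1\<close>, \<open>C = N\<^sub>1 + I - L\<^sub>1\<close>,
  \<open>W = \<Omega>\<^sub>1 - A\<^sub>1\<close> and \<open>p = r q\<close>. It is Lipschitz in a vectorial sense: the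
  componentwise distance of the images of \<open>x\<close> and \<open>y\<close> is at most \<open>T \<bar>x - y\<bar>\<close> for the
  nonnegative matrix \<open>T = \<bar>B\<bar> (\<bar>C\<bar> + \<bar>W\<bar>)\<close> (lemma \<open>abs_step_le\<close>). Multiplication by a
  nonnegative matrix is monotone, so comparing with the fixed point \<open>s\<^sup>*\<close> and iterating gives
  \<open>\<bar>s k - s\<^sup>*\<bar> \<le> T\<^sup>k \<bar>s 0 - s\<^sup>*\<bar>\<close> (lemma \<open>le_pow_mat_mult_vec\<close>).

  It remains to see that \<open>T\<^sup>k\<close> tends to zero when the spectral radius of \<open>T\<close> is below one
  (lemma \<open>pow_mat_tendsto_zero\<close>). The Jordan normal form shows that the powers of a complex matrix
  with spectral radius below one are bounded. Choosing \<open>t\<close> strictly between the spectral radius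
  and one, this applies to \<open>T / t\<close> as well, so the entries of \<open>T\<^sup>k\<close> are \<open>O(t\<^sup>k)\<close>.
\<close>

section \<open>Powers of a matrix with spectral radius below one\<close>

lemma pow_mat_smult:
  fixes A :: "'a :: comm_semiring_1 mat"
  assumes A: "A \<in> carrier_mat n n"
  shows "(c \<cdot>\<^sub>m A) ^\<^sub>m k = c ^ k \<cdot>\<^sub>m A ^\<^sub>m k"
proof (induction k)
  case 0
  show ?case using A by auto
next
  case (Suc k)
  have P: "A ^\<^sub>m k \<in> carrier_mat n n" using A by simp
  have "(c \<cdot>\<^sub>m A) ^\<^sub>m Suc k = (c ^ k \<cdot>\<^sub>m A ^\<^sub>m k) * (c \<cdot>\<^sub>m A)"
    using Suc by simp
  also have "\<dots> = c ^ Suc k \<cdot>\<^sub>m A ^\<^sub>m Suc k"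
    using A P by (intro eq_matI) (auto simp: mult.assoc mult.left_commute)
  finally show ?case .
qed

lemma eigenvalue_smult:
  fixes A :: "'a :: field mat"
  assumes A: "A \<in> carrier_mat n n" and c: "c \<noteq> 0" and ev: "eigenvalue (c \<cdot>\<^sub>m A) l"
  shows "eigenvalue A (l / c)"
proof -
  obtain v where v: "v \<in> carrier_vec n" "v \<noteq> 0\<^sub>v n" "(c \<cdot>\<^sub>m A) *\<^sub>v v = l \<cdot>\<^sub>v v"
    using ev A unfolding eigenvalue_def eigenvector_def by auto
  have eq: "c * ((A *\<^sub>v v) $ i) = l * (v $ i)" if i: "i < n" for i
    using arg_cong[OF v(3), of "\<lambda>w. w $ i"] i A v(1) by simp
  have "A *\<^sub>v v = (l / c) \<cdot>\<^sub>v v"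
  proof (rule eq_vecI)
    fix i assume "i < dim_vec ((l / c) \<cdot>\<^sub>v v)"
    with v(1) have i: "i < n" by simp
    from eq[OF i] c have "(A *\<^sub>v v) $ i = l / c * v $ i" by (simp add: field_simps)
    then show "(A *\<^sub>v v) $ i = ((l / c) \<cdot>\<^sub>v v) $ i" using i v(1) by simp
  qed (use A v(1) in auto)
  then show ?thesis
    using A v(1,2) unfolding eigenvalue_def eigenvector_def by auto
qed

lemma spectral_radius_smult_less_1:
  assumes A: "A \<in> carrier_mat n n" and n: "n > 0"
    and c: "c \<noteq> 0" and small: "norm c * spectral_radius A < 1"
  shows "spectral_radius (c \<cdot>\<^sub>m A) < 1"
proof -
  have cA: "c \<cdot>\<^sub>m A \<in> carrier_mat n n" using A by simp
  obtain l where l: "eigenvalue (c \<cdot>\<^sub>m A) l" "spectral_radius (c \<cdot>\<^sub>m A) = norm l"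
    using spectral_radius_mem_max(1)[OF cA n] by (auto simp: spectrum_def)
  have "norm (l / c) \<le> spectral_radius A"
    using eigenvalue_smult[OF A c l(1)] by (intro spectral_radius_mem_max(2)[OF A n])
      (auto simp: spectrum_def)
  then have "norm l \<le> norm c * spectral_radius A"
    using c by (simp add: norm_divide field_simps)
  with small l(2) show ?thesis by simp
qed

text \<open>
  The condition on the spectral radius is strict, so the matrix can be divided by some \<open>t < 1\<close>
  without losing the boundedness of its powers; the powers of the original matrix then decay
  like \<open>t\<^sup>k\<close>.
\<close>

lemma pow_mat_tendsto_zero:
  fixes A :: "complex mat"
  assumes A: "A \<in> carrier_mat n n" and sr: "spectral_radius A < 1"
    and i: "i < n" and j: "j < n"
  shows "(\<lambda>k. (A ^\<^sub>m k) $$ (i, j)) \<longlonglongrightarrow> 0"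
proof -
  have n: "n > 0" using i by simp
  have "spectral_radius A \<ge> 0"
    using spectral_radius_mem_max(1)[OF A n] by auto
  with sr obtain t where t: "spectral_radius A < t" "t < 1" "0 < t"
    by (metis dense order.strict_trans1)
  define c where "c = complex_of_real (1 / t)"
  have c0: "c \<noteq> 0" and nc: "norm c = 1 / t"
    using t unfolding c_def by (simp_all add: norm_divide)
  have cA: "c \<cdot>\<^sub>m A \<in> carrier_mat n n" using A by simp
  have "spectral_radius (c \<cdot>\<^sub>m A) < 1"
    using t nc by (intro spectral_radius_smult_less_1[OF A n c0]) simp
  from spectral_radius_jnf_norm_bound_less_1_upper_triangular[OF cA this]
  obtain b where b: "\<And>k. norm_bound ((c \<cdot>\<^sub>m A) ^\<^sub>m k) b" by blast
  have bound: "norm ((A ^\<^sub>m k) $$ (i, j)) \<le> b * t ^ k" for k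
  proof -
    have "norm (((c \<cdot>\<^sub>m A) ^\<^sub>m k) $$ (i, j)) \<le> b"
      using b[of k] i j carrier_matD[OF pow_carrier_mat[OF cA, of k]]
      unfolding norm_bound_def by metis
    moreover have "((c \<cdot>\<^sub>m A) ^\<^sub>m k) $$ (i, j) = c ^ k * (A ^\<^sub>m k) $$ (i, j)"
      using i j A by (simp add: pow_mat_smult[OF A])
    ultimately have "(1 / t) ^ k * norm ((A ^\<^sub>m k) $$ (i, j)) \<le> b"
      by (simp add: norm_mult norm_power nc)
    then show ?thesis using t by (simp add: field_simps)
  qed
  have "(\<lambda>k. b * t ^ k) \<longlonglongrightarrow> 0"
    using t by (intro tendsto_mult_right_zero LIMSEQ_power_zero) simp
  then show ?thesis
    by (rule tendsto_0_le[where K = 1])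
      (auto intro!: always_eventually order_trans[OF bound])
qed

lemma real_pow_mat_tendsto_zero:
  assumes A: "A \<in> carrier_mat n n" and sr: "real_spectral_radius A < 1"
    and i: "i < n" and j: "j < n"
  shows "(\<lambda>k. (A ^\<^sub>m k) $$ (i, j)) \<longlonglongrightarrow> 0"
proof -
  let ?C = "map_mat complex_of_real A"
  have "(\<lambda>k. (?C ^\<^sub>m k) $$ (i, j)) \<longlonglongrightarrow> 0"
    using A sr i j unfolding real_spectral_radius_def
    by (intro pow_mat_tendsto_zero[of _ n]) auto
  moreover have "(?C ^\<^sub>m k) $$ (i, j) = complex_of_real ((A ^\<^sub>m k) $$ (i, j))" for k
  proof -
    have "?C ^\<^sub>m k = map_mat complex_of_real (A ^\<^sub>m k)"
      by (rule of_real_hom.mat_hom_pow[OF A, symmetric])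
    then show ?thesis using A i j by simp
  qed
  ultimately have "(\<lambda>k. complex_of_real ((A ^\<^sub>m k) $$ (i, j))) \<longlonglongrightarrow> 0"
    by (simp only:)
  from tendsto_Re[OF this] show ?thesis by simp
qed

section \<open>Entrywise absolute values\<close>

lemma abs_mat_carrier [simp]: "abs_mat A \<in> carrier_mat m n \<longleftrightarrow> A \<in> carrier_mat m n"
  by (simp add: abs_mat_def)

lemma abs_vec_carrier [simp]: "abs_vec x \<in> carrier_vec n \<longleftrightarrow> x \<in> carrier_vec n"
  by (simp add: abs_vec_def)

lemma mult_mat_vec_sum:
  assumes "A \<in> carrier_mat m n" "x \<in> carrier_vec n" "i < m"
  shows "(A *\<^sub>v x) $ i = (\<Sum>j<n. A $$ (i, j) * x $ j)"
  using assms by (auto simp: scalar_prod_def lessThan_atLeast0 intro!: sum.cong)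

lemma mult_mat_vec_mono:
  fixes A :: "real mat"
  assumes A: "A \<in> carrier_mat m n" and nonneg: "\<And>i j. i < m \<Longrightarrow> j < n \<Longrightarrow> 0 \<le> A $$ (i, j)"
    and y: "y \<in> carrier_vec n" and xy: "x \<le> y"
  shows "A *\<^sub>v x \<le> A *\<^sub>v y"
proof -
  have x: "x \<in> carrier_vec n" using xy y unfolding less_eq_vec_def carrier_vec_def by simp
  have "(A *\<^sub>v x) $ i \<le> (A *\<^sub>v y) $ i" if i: "i < m" for i
    unfolding mult_mat_vec_sum[OF A x i] mult_mat_vec_sum[OF A y i]
    using nonneg[OF i] xy y by (intro sum_mono mult_left_mono) (auto simp: less_eq_vec_def)
  then show ?thesis using A by (auto simp: less_eq_vec_def)
qed

lemma abs_mult_mat_vec_le: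
  assumes A: "A \<in> carrier_mat m n" and x: "x \<in> carrier_vec n"
  shows "abs_vec (A *\<^sub>v x) \<le> abs_mat A *\<^sub>v abs_vec x"
proof -
  have "\<bar>(A *\<^sub>v x) $ i\<bar> \<le> (abs_mat A *\<^sub>v abs_vec x) $ i" if i: "i < m" for i
  proof -
    have "\<bar>(A *\<^sub>v x) $ i\<bar> \<le> (\<Sum>j<n. \<bar>A $$ (i, j) * x $ j\<bar>)"
      unfolding mult_mat_vec_sum[OF A x i] by (rule sum_abs)
    also have "\<dots> = (\<Sum>j<n. abs_mat A $$ (i, j) * abs_vec x $ j)"
      using A x i by (intro sum.cong) (auto simp: abs_mat_def abs_vec_def abs_mult)
    also have "\<dots> = (abs_mat A *\<^sub>v abs_vec x) $ i"
      using A x i by (intro mult_mat_vec_sum[symmetric]) auto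
    finally show ?thesis .
  qed
  then show ?thesis using A by (auto simp: less_eq_vec_def abs_vec_def abs_mat_def)
qed

section \<open>Componentwise contractions\<close>

text \<open>
  Nonnegativity of \<open>T\<close> is what permits applying \<open>T\<close> to both sides of the bound for \<open>e k\<close>.
\<close>

lemma le_pow_mat_mult_vec:
  fixes T :: "real mat"
  assumes T: "T \<in> carrier_mat n n" and nonneg: "\<And>i j. i < n \<Longrightarrow> j < n \<Longrightarrow> 0 \<le> T $$ (i, j)"
    and e: "\<And>k. e k \<in> carrier_vec n" and step: "\<And>k. e (Suc k) \<le> T *\<^sub>v e k"
  shows "e k \<le> T ^\<^sub>m k *\<^sub>v e 0"
proof (induction k)
  case 0
  show ?case using e[of 0] T by simp
next
  case (Suc k)
  interpret semiring "ring_mat TYPE(real) n ()" by (rule semiring_mat)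
  have P: "T ^\<^sub>m k \<in> carrier_mat n n" using T by simp
  \<comment> \<open>Powers are defined by multiplication on the right, the estimate multiplies on the left.\<close>
  have comm: "T * T ^\<^sub>m k = T ^\<^sub>m Suc k"
    using nat_pow_Suc2[of T k] T
    by (simp add: pow_mat_ring_pow[OF T, of _ "()"] ring_mat_simps)
  have "e (Suc k) \<le> T *\<^sub>v e k" by (rule step)
  also have "\<dots> \<le> T *\<^sub>v (T ^\<^sub>m k *\<^sub>v e 0)"
    using P e[of 0] Suc by (intro mult_mat_vec_mono[OF T nonneg]) auto
  also have "\<dots> = T ^\<^sub>m Suc k *\<^sub>v e 0"
    unfolding comm[symmetric] using assoc_mult_mat_vec[OF T P e] by simp
  finally show ?case .
qed

lemma vec_converges_if_contractive:
  assumes T: "T \<in> carrier_mat n n" and nonneg: "\<And>i j. i < n \<Longrightarrow> j < n \<Longrightarrow> 0 \<le> T $$ (i, j)"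
    and sr: "real_spectral_radius T < 1"
    and x: "\<And>k. x k \<in> carrier_vec n" and l: "l \<in> carrier_vec n"
    and step: "\<And>k. abs_vec (x (Suc k) - l) \<le> T *\<^sub>v abs_vec (x k - l)"
  shows "vec_converges n x l"
proof -
  define e where "e k = abs_vec (x k - l)" for k
  have e: "e k \<in> carrier_vec n" for k using x l by (simp add: e_def)
  have P: "T ^\<^sub>m k \<in> carrier_mat n n" for k using T by simp
  have "(\<lambda>k. x k $ i) \<longlonglongrightarrow> l $ i" if i: "i < n" for i
  proof -
    have "\<bar>x k $ i - l $ i\<bar> \<le> (\<Sum>j<n. (T ^\<^sub>m k) $$ (i, j) * e 0 $ j)" for k
    proof -
      have "e k \<le> T ^\<^sub>m k *\<^sub>v e 0"
        by (rule le_pow_mat_mult_vec[OF T nonneg e]) (use step in \<open>auto simp: e_def\<close>)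
      then have "e k $ i \<le> (T ^\<^sub>m k *\<^sub>v e 0) $ i"
        using i T by (simp add: less_eq_vec_def)
      also have "\<dots> = (\<Sum>j<n. (T ^\<^sub>m k) $$ (i, j) * e 0 $ j)"
        by (rule mult_mat_vec_sum[OF P e i])
      finally show ?thesis using i x[of k] l by (simp add: e_def abs_vec_def)
    qed
    then have bound: "norm (x k $ i - l $ i) \<le> norm (\<Sum>j<n. (T ^\<^sub>m k) $$ (i, j) * e 0 $ j) * 1" for k
      unfolding real_norm_def mult_1_right by (rule order_trans[OF _ abs_ge_self])
    have lim: "(\<lambda>k. \<Sum>j<n. (T ^\<^sub>m k) $$ (i, j) * e 0 $ j) \<longlonglongrightarrow> 0"
      by (intro tendsto_null_sum tendsto_mult_left_zero real_pow_mat_tendsto_zero[OF T sr i]) simp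
    have "(\<lambda>k. x k $ i - l $ i) \<longlonglongrightarrow> 0"
      by (rule tendsto_0_le[OF lim always_eventually[OF allI[OF bound]]])
    then show ?thesis by (rule LIM_zero_cancel)
  qed
  then show ?thesis using x l by (simp add: vec_converges_def)
qed

section \<open>The modulus-based iteration\<close>

lemma mat_inv_carrier:
  assumes A: "A \<in> carrier_mat n n" and inv: "invertible_mat A"
  shows "mat_inv A \<in> carrier_mat n n"
proof -
  obtain B where B: "A * B = 1\<^sub>m n" "B * A = 1\<^sub>m (dim_row B)"
    using inv A unfolding invertible_mat_def inverts_mat_def by auto
  have "dim_col (A * B) = n" "dim_col (B * A) = dim_row B" by (simp_all add: B)
  then have "B \<in> carrier_mat n n" using A by auto
  with A B have "A \<in> Units (ring_mat TYPE(real) n ())"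
    unfolding Units_def by (auto simp: ring_mat_simps)
  with mat_inverse(1)[OF A] obtain C where "mat_inverse A = Some C" by fastforce
  with mat_inverse(2)[OF A this] show ?thesis by (simp add: mat_inv_def)
qed

lemma abs_mat_mult_add_nonneg:
  assumes B: "B \<in> carrier_mat m p" and C: "C \<in> carrier_mat p n" and W: "W \<in> carrier_mat p n"
    and "i < m" "j < n"
  shows "0 \<le> (abs_mat B * (abs_mat C + abs_mat W)) $$ (i, j)"
  using assms by (auto simp: scalar_prod_def abs_mat_def intro!: sum_nonneg)

text \<open>
  The offset \<open>p\<close> cancels between the two images, and the nonlinear term is harmless because
  \<open>\<bar>\<bar>a\<bar> - \<bar>b\<bar>\<bar> \<le> \<bar>a - b\<bar>\<close> in every component. What is left is bounded by passing to the
  entrywise absolute values of the matrices.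
\<close>

lemma abs_step_le:
  assumes B: "B \<in> carrier_mat n n" and C: "C \<in> carrier_mat n n" and W: "W \<in> carrier_mat n n"
    and p: "p \<in> carrier_vec n" and x: "x \<in> carrier_vec n" and y: "y \<in> carrier_vec n"
  shows "abs_vec (B *\<^sub>v (C *\<^sub>v x + W *\<^sub>v abs_vec x - p) - B *\<^sub>v (C *\<^sub>v y + W *\<^sub>v abs_vec y - p))
    \<le> abs_mat B * (abs_mat C + abs_mat W) *\<^sub>v abs_vec (x - y)"
proof -
  let ?d = "x - y" and ?a = "abs_vec x - abs_vec y"
  have d: "?d \<in> carrier_vec n" and a: "?a \<in> carrier_vec n" using x y by auto
  have ax: "abs_vec x \<in> carrier_vec n" and ay: "abs_vec y \<in> carrier_vec n" using x y by auto
  have aa: "abs_vec ?a \<le> abs_vec ?d"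
    using x y by (auto simp: less_eq_vec_def abs_vec_def)
  have "C *\<^sub>v x + W *\<^sub>v abs_vec x - p - (C *\<^sub>v y + W *\<^sub>v abs_vec y - p)
      = (C *\<^sub>v x - C *\<^sub>v y) + (W *\<^sub>v abs_vec x - W *\<^sub>v abs_vec y)"
    using C W p by (intro eq_vecI) auto
  also have "\<dots> = C *\<^sub>v ?d + W *\<^sub>v ?a"
    by (simp only: mult_minus_distrib_mat_vec[OF C x y] mult_minus_distrib_mat_vec[OF W ax ay])
  finally have diff: "B *\<^sub>v (C *\<^sub>v x + W *\<^sub>v abs_vec x - p) - B *\<^sub>v (C *\<^sub>v y + W *\<^sub>v abs_vec y - p)
      = B *\<^sub>v (C *\<^sub>v ?d + W *\<^sub>v ?a)"
    using C W p x y
    by (subst mult_minus_distrib_mat_vec[OF B, symmetric])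
      (auto intro!: minus_carrier_vec add_carrier_vec mult_mat_vec_carrier)
  have "abs_vec (C *\<^sub>v ?d + W *\<^sub>v ?a) \<le> abs_vec (C *\<^sub>v ?d) + abs_vec (W *\<^sub>v ?a)"
    using C W by (auto simp: less_eq_vec_def abs_vec_def abs_triangle_ineq)
  also have "\<dots> \<le> abs_mat C *\<^sub>v abs_vec ?d + abs_mat W *\<^sub>v abs_vec ?d"
  proof -
    have "abs_vec (W *\<^sub>v ?a) \<le> abs_mat W *\<^sub>v abs_vec ?a" by (rule abs_mult_mat_vec_le[OF W a])
    also have "\<dots> \<le> abs_mat W *\<^sub>v abs_vec ?d"
      using W aa d by (intro mult_mat_vec_mono[of _ n n]) (auto simp: abs_mat_def abs_vec_def)
    finally show ?thesis
      using abs_mult_mat_vec_le[OF C d] C W by (auto simp: less_eq_vec_def intro!: add_mono)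
  qed
  also have "\<dots> = (abs_mat C + abs_mat W) *\<^sub>v abs_vec ?d"
    using C W d by (intro add_mult_distrib_mat_vec[symmetric]) auto
  finally have inner: "abs_vec (C *\<^sub>v ?d + W *\<^sub>v ?a) \<le> (abs_mat C + abs_mat W) *\<^sub>v abs_vec ?d" .
  have "abs_vec (B *\<^sub>v (C *\<^sub>v ?d + W *\<^sub>v ?a)) \<le> abs_mat B *\<^sub>v abs_vec (C *\<^sub>v ?d + W *\<^sub>v ?a)"
    using C W d a by (intro abs_mult_mat_vec_le[OF B]) auto
  also have "\<dots> \<le> abs_mat B *\<^sub>v ((abs_mat C + abs_mat W) *\<^sub>v abs_vec ?d)"
    using B C W d inner
    by (intro mult_mat_vec_mono[of _ n n] mult_mat_vec_carrier[of _ n n] add_carrier_mat)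
      (auto simp: abs_mat_def)
  also have "\<dots> = abs_mat B * (abs_mat C + abs_mat W) *\<^sub>v abs_vec ?d"
    using B C W d by (intro assoc_mult_mat_vec[symmetric, of _ n n _ n]) auto
  finally show ?thesis unfolding diff .
qed

theorem theorem4p1:
  fixes n :: nat
    and A\<^sub>1 M\<^sub>1 N\<^sub>1 D\<^sub>1 L\<^sub>1 U\<^sub>1 \<Omega>\<^sub>1 :: "real mat"
    and q s_star :: "real vec"
    and r :: real
    and s :: "nat \<Rightarrow> real vec"
  assumes "A\<^sub>1 \<in> carrier_mat n n" and "P_matrix A\<^sub>1"
    and "q \<in> carrier_vec n" and "r > 0"
    and "D\<^sub>1 \<in> carrier_mat n n" and "diagonal_mat D\<^sub>1"
    and "L\<^sub>1 \<in> carrier_mat n n" and "strictly_lower_triangular L\<^sub>1"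
    and "U\<^sub>1 \<in> carrier_mat n n" and "strictly_upper_triangular U\<^sub>1"
    and "A\<^sub>1 = D\<^sub>1 - L\<^sub>1 - U\<^sub>1"
    and "M\<^sub>1 \<in> carrier_mat n n" and "N\<^sub>1 \<in> carrier_mat n n" and "A\<^sub>1 = M\<^sub>1 - N\<^sub>1"
    and "\<Omega>\<^sub>1 \<in> carrier_mat n n" and "positive_diagonal_mat \<Omega>\<^sub>1"
    and "invertible_mat (M\<^sub>1 + \<Omega>\<^sub>1 + 1\<^sub>m n - L\<^sub>1)"
    and "s_star \<in> carrier_vec n"
    and "s_star = mat_inv (M\<^sub>1 + \<Omega>\<^sub>1 + 1\<^sub>m n - L\<^sub>1) *\<^sub>v
          ((N\<^sub>1 + 1\<^sub>m n - L\<^sub>1) *\<^sub>v s_star + (\<Omega>\<^sub>1 - A\<^sub>1) *\<^sub>v abs_vec s_star - r \<cdot>\<^sub>v q)"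
    and "real_spectral_radius
          (abs_mat (mat_inv (M\<^sub>1 + 1\<^sub>m n - L\<^sub>1 + \<Omega>\<^sub>1)) *
            (abs_mat (N\<^sub>1 + 1\<^sub>m n - L\<^sub>1) + abs_mat (\<Omega>\<^sub>1 - A\<^sub>1))) < 1"
    and "s 0 \<in> carrier_vec n"
    and "\<And>k. s (Suc k) = mat_inv (M\<^sub>1 + \<Omega>\<^sub>1 + 1\<^sub>m n - L\<^sub>1) *\<^sub>v
          ((N\<^sub>1 + 1\<^sub>m n - L\<^sub>1) *\<^sub>v s k + (\<Omega>\<^sub>1 - A\<^sub>1) *\<^sub>v abs_vec (s k) - r \<cdot>\<^sub>v q)"
  shows "vec_converges n s s_star"
proof -
  note A = assms(1) and q = assms(3) and L = assms(7) and M = assms(12) and N = assms(13)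
    and \<Omega> = assms(15) and inv = assms(17) and sol = assms(18) and fixpoint = assms(19)
    and sr = assms(20) and init = assms(21) and iter = assms(22)
  let ?B = "mat_inv (M\<^sub>1 + \<Omega>\<^sub>1 + 1\<^sub>m n - L\<^sub>1)"
  let ?C = "N\<^sub>1 + 1\<^sub>m n - L\<^sub>1" and ?W = "\<Omega>\<^sub>1 - A\<^sub>1"
  let ?T = "abs_mat ?B * (abs_mat ?C + abs_mat ?W)"
  have B: "?B \<in> carrier_mat n n"
    using L M \<Omega> by (intro mat_inv_carrier[OF _ inv]) auto
  have C: "?C \<in> carrier_mat n n" and W: "?W \<in> carrier_mat n n" and p: "r \<cdot>\<^sub>v q \<in> carrier_vec n"
    using A L N \<Omega> q by auto
  have T: "?T \<in> carrier_mat n n"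
    using B C W by (intro mult_carrier_mat[of _ n n]) auto
  have T_nonneg: "0 \<le> ?T $$ (i, j)" if "i < n" "j < n" for i j
    by (rule abs_mat_mult_add_nonneg[OF B C W that])
  have "M\<^sub>1 + 1\<^sub>m n - L\<^sub>1 + \<Omega>\<^sub>1 = M\<^sub>1 + \<Omega>\<^sub>1 + 1\<^sub>m n - L\<^sub>1"
    using L M \<Omega> by (intro eq_matI) auto
  with sr have T_sr: "real_spectral_radius ?T < 1" by simp
  have s: "s k \<in> carrier_vec n" for k
  proof (cases k)
    case (Suc k')
    have "dim_vec (s k) = n" using B unfolding Suc iter[of k'] by simp
    then show ?thesis by (rule carrier_vecI)
  qed (use init in simp)
  have "abs_vec (s (Suc k) - s_star) \<le> ?T *\<^sub>v abs_vec (s k - s_star)" for k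
    using abs_step_le[OF B C W p s[of k] sol]
    unfolding iter[symmetric] fixpoint[symmetric] .
  then show ?thesis
    by (intro vec_converges_if_contractive[OF T T_nonneg T_sr s sol])
qed

end
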